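(* Let $f(n)$ be a multiplicative (complex-valued) arithmetic function and suppose that the associated Dirichlet series $F(s)=\sum_{n\geq 1} f(n)n^{-s}$ is absolutely convergent for $\sigma>1$. Suppose furthermore that: (i) for some positive integer $d$ there are complex numbers $f_j(p)$ ($p$ prime, $1\le j\le d$) such that $\log F(s) = -\sum_p \sum_{j=1}^d\log(1-f_j(p)p^{-s})$ for $\sigma>1$, with $|f_j(p)|\leq 1$ for every prime $p$ and any $j=1,\ldots,d$; (ii) $\sum_{n\leq x} |f(n)|^2\ll x$ for every $x\geq 1$; (iii) there exist positive constants $x_0$ and $A>6$ such that for any $x\geq x_0$ we have $$\sum_{p\leq x} |f(p)|^2 \gg \frac{x}{\log x}$$ and $$\sum_{p\leq x} |f(p)|^2\chi(p) \ll \frac{1}{\phi(q)}\frac{x}{\log^2 x}$$ for every non-principal Dirichlet character $\chi$ mod $q$, with $q\leq (\log x)^A$. Let $0<\lambda< 1$ be a real number with $\lambda\neq 1/2$. Then for any sequence $\{x_n\}\subset(0,1]$ such that $x_n\rightarrow \lambda$ as $n\rightarrow \infty$ we have $\sigma^*(F,x_n)\rightarrow \sigma^*(F,\lambda)$ as $n\rightarrow \infty$.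
   Context: Notation: $s=\sigma+it$ is a complex variable, $e(z)=e^{2\pi i z}$, $p$ denotes primes, $\phi$ is Euler's totient function. In (i) the identity is the logarithmic form of the Euler product $F(s)=\prod_p\prod_{j=1}^d(1-f_j(p)p^{-s})^{-1}$ (principal branch of the logarithm on the right-hand side). The implied constants in (ii) and (iii) are independent of $x$, $q$ and $\chi$. For $0<\lambda\le 1$ and $\sigma>1$ put $F(\lambda,1,1,s)=\sum_{n\ge1} f(n)e(\lambda n)n^{-s}$, and define $$\sigma^*(F,\lambda)=\inf\{\sigma_0\ge 1 \mid F(\lambda,1,1,s)\neq 0\ \text{for all } s \text{ with } \sigma>\sigma_0\}.$$ *)

theory Defs
  imports "HOL-Analysis.Analysis" "HOL-Number_Theory.Number_Theory"
begin

(* The value f 0 is irrelevant throughout: all series and sums run over n \<ge> 1. *)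
definition multiplicative_fun :: "(nat \<Rightarrow> complex) \<Rightarrow> bool" where
  "multiplicative_fun f \<longleftrightarrow>
     f 1 = 1 \<and> (\<forall>m n. m \<ge> 1 \<longrightarrow> n \<ge> 1 \<longrightarrow> coprime m n \<longrightarrow> f (m * n) = f m * f n)"

(* ch 1 = 1 follows from complete multiplicativity and ch 1 \<noteq> 0. *)
definition dirichlet_character :: "nat \<Rightarrow> (nat \<Rightarrow> complex) \<Rightarrow> bool" where
  "dirichlet_character q ch \<longleftrightarrow>
     q \<ge> 1 \<and>
     (\<forall>a b. ch (a * b) = ch a * ch b) \<and>
     (\<forall>a. ch (a + q) = ch a) \<and>
     (\<forall>a. ch a \<noteq> 0 \<longleftrightarrow> coprime a q)"

definition principal_character :: "nat \<Rightarrow> nat \<Rightarrow> complex" where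
  "principal_character q a = (if coprime a q then 1 else 0)"

definition unit_exp :: "complex \<Rightarrow> complex" where
  "unit_exp z = exp (2 * of_real pi * \<i> * z)"

definition dirichlet_sum :: "(nat \<Rightarrow> complex) \<Rightarrow> complex \<Rightarrow> complex" where
  "dirichlet_sum f s = (\<Sum>\<^sub>\<infinity>n\<in>{1..}. f n * of_nat n powr (- s))"

definition linear_twist :: "(nat \<Rightarrow> complex) \<Rightarrow> real \<Rightarrow> complex \<Rightarrow> complex" where
  "linear_twist f lam s =
     (\<Sum>\<^sub>\<infinity>n\<in>{1..}. f n * unit_exp (of_real lam * of_nat n) * of_nat n powr (- s))"

(* The infimum is that of a set bounded below by 1. The set is nonempty whenever f 1 \<noteq> 0 and the
   Dirichlet series of f converges absolutely for Re s > 1: the term n = 1 dominates for large Re s. *)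
definition sigma_star :: "(nat \<Rightarrow> complex) \<Rightarrow> real \<Rightarrow> real" where
  "sigma_star f lam = Inf {\<sigma>0. \<sigma>0 \<ge> 1 \<and> (\<forall>s. Re s > \<sigma>0 \<longrightarrow> linear_twist f lam s \<noteq> 0)}"

end

theory Submission
  imports Defs "HOL-Complex_Analysis.Great_Picard" "HOL-Real_Asymp.Real_Asymp"
begin

text \<open>
  The idea is compactness. Write \<open>L\<^sub>\<lambda>(s)\<close> for the linear twist. All the series that occur have
  coefficients bounded in modulus by \<open>|f n|\<close>, so pointwise convergence of coefficients forces
  uniform convergence of the Dirichlet series on every half-plane \<open>Re s \<ge> \<sigma> > 1\<close>
  (\<open>uniform_limit_dirichlet_sum\<close>). By Hurwitz's theorem a limit of such series, if none of them
  vanishes on \<open>Re s > \<sigma>\<close>, does not vanish there either, as soon as the limit has first coefficient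
  nonzero and hence is not identically zero (\<open>zero_free_limit\<close>). This is used twice.

  Lower semicontinuity: if \<open>x\<^sub>k\<close> tends to \<open>\<lambda>\<close>, then the coefficients \<open>f(n) e(x\<^sub>k n)\<close> converge to
  \<open>f(n) e(\<lambda> n)\<close>, so a common zero-free half-plane of the twists by the \<open>x\<^sub>k\<close> is also one of
  \<open>L\<^sub>\<lambda>\<close> (\<open>sigma_star_le_limit\<close>).

  Upper semicontinuity: suppose the twist by \<open>x\<^sub>k\<close> vanishes at \<open>\<sigma>\<^sub>k + i t\<^sub>k\<close>, where every \<open>\<sigma>\<^sub>k\<close>
  exceeds \<open>\<sigma>\<^sup>*(\<lambda>)\<close> by at least a fixed amount. The \<open>t\<^sub>k\<close> may be unbounded, but the \<open>\<sigma>\<^sub>k\<close> are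
  bounded, and the numbers \<open>n powr (- i t\<^sub>k)\<close> lie on the unit circle. Along a subsequence,
  \<open>\<sigma>\<^sub>k\<close> converges to some \<open>\<sigma>\<close>, and \<open>n powr (- i t\<^sub>k)\<close> converges for every \<open>n\<close> to some \<open>w(n)\<close>.
  The series \<open>G\<close> with coefficients \<open>f(n) e(\<lambda> n) w(n)\<close> is the limit of the vertical translates by
  \<open>i t\<^sub>k\<close> of the twists by \<open>x\<^sub>k\<close>, so \<open>G(\<sigma>) = 0\<close>. But it is also the limit of the translates
  \<open>L\<^sub>\<lambda>(s + i t\<^sub>k)\<close> of the single function \<open>L\<^sub>\<lambda>\<close>, none of which vanishes on
  \<open>Re s > \<sigma>\<^sup>*(\<lambda>)\<close>, so \<open>G\<close> does not vanish there: a contradiction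
  (\<open>limit_of_zeros_le_sigma_star\<close>).
\<close>

section \<open>Dirichlet series under a common majorant\<close>

locale dirichlet_majorant =
  fixes b :: "nat \<Rightarrow> real"
  assumes summable_majorant: "\<And>\<sigma>. \<sigma> > 1 \<Longrightarrow> summable (\<lambda>n. b n * real n powr (- \<sigma>))"
begin

lemma norm_term_le:
  assumes "norm (c n) \<le> b n" "Re s \<ge> \<sigma>"
  shows "norm (c n * of_nat n powr (- s)) \<le> b n * real n powr (- \<sigma>)"
proof (cases "n = 0")
  case False
  then have "norm (of_nat n powr (- s) :: complex) = real n powr (- Re s)"
    by (subst norm_powr_real_powr) auto
  moreover have "real n powr (- Re s) \<le> real n powr (- \<sigma>)"
    using False assms(2) by (intro powr_mono) auto
  moreover have "b n \<ge> 0"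
    using assms(1) norm_ge_zero order_trans by blast
  ultimately show ?thesis
    using assms(1) by (auto simp: norm_mult intro!: mult_mono)
qed auto

lemma summable_norm_terms:
  assumes "\<And>n. norm (c n) \<le> b n" "Re s > 1"
  shows "summable (\<lambda>n. norm (c n * of_nat n powr (- s)))"
  by (rule summable_comparison_test'[OF summable_majorant[OF assms(2)], of 0])
     (use norm_term_le[where c = c, OF assms(1) order.refl] in auto)

text \<open>The index \<open>0\<close> may be included because \<open>0 powr z = 0\<close>.\<close>

lemma dirichlet_sum_eq_suminf:
  assumes "\<And>n. norm (c n) \<le> b n" "Re s > 1"
  shows "dirichlet_sum c s = (\<Sum>n. c n * of_nat n powr (- s))"
proof -
  have "dirichlet_sum c s = (\<Sum>\<^sub>\<infinity>n. c n * of_nat n powr (- s))"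
    unfolding dirichlet_sum_def by (rule infsum_cong_neutral) (auto simp: not_le)
  also have "\<dots> = (\<Sum>n. c n * of_nat n powr (- s))"
    by (intro infsumI norm_summable_imp_has_sum summable_norm_terms assms summable_sums
          summable_norm_cancel[OF summable_norm_terms])
  finally show ?thesis .
qed

text \<open>Dominated convergence for the distance of the coefficients in the weighted \<open>\<ell>\<^sup>1\<close> norm, which
  bounds the distance of the Dirichlet series uniformly on a closed half-plane.\<close>

lemma uniform_limit_dirichlet_sum:
  assumes c: "\<And>k n. norm (c k n) \<le> b n" and c': "\<And>n. norm (c' n) \<le> b n"
    and lim: "\<And>n. n \<ge> 1 \<Longrightarrow> (\<lambda>k. c k n) \<longlonglongrightarrow> c' n"
    and \<sigma>: "\<sigma> > 1"
  shows "uniform_limit {s. Re s \<ge> \<sigma>} (\<lambda>k. dirichlet_sum (c k)) (dirichlet_sum c') sequentially"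
proof -
  define a where "a = (\<lambda>n k. norm (c k n - c' n) * real n powr (- \<sigma>))"
  have a_le: "a n k \<le> 2 * (b n * real n powr (- \<sigma>))" and a_nonneg: "a n k \<ge> 0" for n k
  proof -
    have "norm (c k n - c' n) \<le> 2 * b n"
      using norm_triangle_ineq4[of "c k n" "c' n"] c[of k n] c'[of n] by linarith
    then show "a n k \<le> 2 * (b n * real n powr (- \<sigma>))"
      unfolding a_def mult.assoc[symmetric] by (rule mult_right_mono) auto
  qed (auto simp: a_def)
  have summ2: "summable (\<lambda>n. 2 * (b n * real n powr (- \<sigma>)))"
    by (intro summable_mult summable_majorant \<sigma>)
  have a_summable: "summable (\<lambda>n. a n k)" for k
    by (rule summable_comparison_test'[OF summ2, of 0]) (use a_le a_nonneg in auto)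
  have a_lim: "(\<lambda>k. a n k) \<longlonglongrightarrow> 0" for n
  proof (cases "n = 0")
    case False
    then have "(\<lambda>k. c k n - c' n) \<longlonglongrightarrow> 0"
      using lim[of n] by (auto simp: LIM_zero_iff)
    then show ?thesis
      unfolding a_def by (intro tendsto_mult_left_zero tendsto_norm_zero)
  qed (auto simp: a_def)
  have "(\<lambda>k. \<Sum>n. a n k) \<longlonglongrightarrow> (\<Sum>n. 0)"
    using tannerys_theorem[of a "\<lambda>_. 0" sequentially "\<lambda>n. 2 * (b n * real n powr (- \<sigma>))"]
      a_lim a_le a_nonneg summ2 by (auto intro!: always_eventually)
  then have sum_lim: "(\<lambda>k. \<Sum>n. a n k) \<longlonglongrightarrow> 0"
    by simp
  have bound: "dist (dirichlet_sum (c k) s) (dirichlet_sum c' s) \<le> (\<Sum>n. a n k)"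
    if "Re s \<ge> \<sigma>" for k s
  proof -
    have s: "Re s > 1" using that \<sigma> by linarith
    let ?t = "\<lambda>n. of_nat n powr (- s) :: complex"
    have le: "norm (c k n * ?t n - c' n * ?t n) \<le> a n k" for n
    proof (cases "n = 0")
      case False
      then have "norm (?t n) = real n powr (- Re s)"
        by (subst norm_powr_real_powr) auto
      also have "\<dots> \<le> real n powr (- \<sigma>)"
        using False that by (intro powr_mono) auto
      finally show ?thesis
        unfolding a_def left_diff_distrib[symmetric] norm_mult by (intro mult_left_mono) auto
    qed (auto simp: a_def)
    have "dirichlet_sum (c k) s - dirichlet_sum c' s = (\<Sum>n. c k n * ?t n - c' n * ?t n)"
      using s by (simp add: dirichlet_sum_eq_suminf[OF c] dirichlet_sum_eq_suminf[OF c']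
          suminf_diff summable_norm_cancel[OF summable_norm_terms[OF c]]
          summable_norm_cancel[OF summable_norm_terms[OF c']])
    then show ?thesis
      using le a_summable by (simp add: dist_norm norm_suminf_le)
  qed
  show ?thesis
  proof (rule uniform_limitI)
    fix e :: real assume "e > 0"
    with sum_lim have "\<forall>\<^sub>F k in sequentially. (\<Sum>n. a n k) < e"
      by (rule order_tendstoD)
    then show "\<forall>\<^sub>F k in sequentially. \<forall>s\<in>{s. Re s \<ge> \<sigma>}.
        dist (dirichlet_sum (c k) s) (dirichlet_sum c' s) < e"
      by eventually_elim (use bound in \<open>auto intro: le_less_trans\<close>)
  qed
qed

text \<open>Partial sums are the Dirichlet series with truncated coefficients, so holomorphy is another
  instance of the uniform convergence above.\<close>

lemma holomorphic_dirichlet_sum: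
  assumes c: "\<And>n. norm (c n) \<le> b n"
  shows "dirichlet_sum c holomorphic_on {s. Re s > 1}"
proof (rule holomorphic_uniform_sequence)
  show "open {s. Re s > 1}" by (rule open_halfspace_Re_gt)
next
  fix k
  have trunc: "norm (if n < k then c n else 0) \<le> b n" for n
    using c[of n] norm_ge_zero[of "c n"] by (auto simp del: norm_ge_zero)
  have "(\<lambda>s. \<Sum>n<k. c n * of_nat n powr (- s)) holomorphic_on {s. Re s > 1}"
  proof (intro holomorphic_on_sum holomorphic_on_mult holomorphic_on_const)
    fix n
    show "(\<lambda>s. of_nat n powr (- s) :: complex) holomorphic_on {s. Re s > 1}"
      by (cases "n = 0") (auto intro!: holomorphic_intros)
  qed
  moreover have "(\<Sum>n<k. c n * of_nat n powr (- s))
      = dirichlet_sum (\<lambda>n. if n < k then c n else 0) s" if "Re s > 1" for s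
  proof -
    have "dirichlet_sum (\<lambda>n. if n < k then c n else 0) s
        = (\<Sum>n. (if n < k then c n else 0) * of_nat n powr (- s))"
      using trunc that by (rule dirichlet_sum_eq_suminf)
    also have "\<dots> = (\<Sum>n<k. (if n < k then c n else 0) * of_nat n powr (- s))"
      by (rule suminf_finite) auto
    finally show ?thesis by simp
  qed
  ultimately show "dirichlet_sum (\<lambda>n. if n < k then c n else 0) holomorphic_on {s. Re s > 1}"
    by (rule holomorphic_transform) auto
next
  fix s :: complex assume "s \<in> {s. Re s > 1}"
  then have s: "Re s > 1" by simp
  \<comment> \<open>half the distance from \<open>s\<close> to the line \<open>Re s = 1\<close>\<close>
  define r where "r = (Re s - 1) / 2"
  have r: "r > 0" and sub: "cball s r \<subseteq> {z. Re z \<ge> 1 + r}"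
  proof -
    show "cball s r \<subseteq> {z. Re z \<ge> 1 + r}"
    proof safe
      fix z assume "z \<in> cball s r"
      then have "\<bar>Re (s - z)\<bar> \<le> r"
        using abs_Re_le_cmod[of "s - z"] by (simp add: dist_norm)
      then have "Re s - Re z \<le> r" by simp
      then show "Re z \<ge> 1 + r" by (simp add: r_def field_simps)
    qed
  qed (use s in \<open>simp add: r_def\<close>)
  have "uniform_limit {z. Re z \<ge> 1 + r} (\<lambda>k. dirichlet_sum (\<lambda>n. if n < k then c n else 0))
          (dirichlet_sum c) sequentially"
  proof (rule uniform_limit_dirichlet_sum)
    fix k n
    show "norm (if n < k then c n else 0) \<le> b n"
      using c[of n] norm_ge_zero[of "c n"] by (auto simp del: norm_ge_zero)
    show "(\<lambda>k. if n < k then c n else 0) \<longlonglongrightarrow> c n"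
      by (rule tendsto_eventually) (use eventually_gt_at_top[of n] in eventually_elim, simp)
  qed (use c r in auto)
  then have "uniform_limit (cball s r) (\<lambda>k. dirichlet_sum (\<lambda>n. if n < k then c n else 0))
          (dirichlet_sum c) sequentially"
    by (rule uniform_limit_on_subset) (rule sub)
  then show "\<exists>d>0. cball s d \<subseteq> {s. Re s > 1} \<and>
      uniform_limit (cball s d) (\<lambda>k. dirichlet_sum (\<lambda>n. if n < k then c n else 0))
        (dirichlet_sum c) sequentially"
    using r sub by (intro exI[of _ r]) force
qed

text \<open>Far to the right the first term dominates. The abscissa depends only on the majorant, which
  is what keeps the zeros of a whole family of series in a common vertical strip.\<close>

lemma uniformly_zero_free_far_right:
  obtains M where "M > 1"
    "\<And>c s. \<lbrakk>\<And>n. norm (c n) \<le> b n; norm (c 1) = 1; Re s \<ge> M\<rbrakk> \<Longrightarrow> dirichlet_sum c s \<noteq> 0"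
proof -
  define B where "B = (\<Sum>n. b n * real n powr (- 2))"
  have "((\<lambda>\<sigma>::real. B * 2 powr (2 - \<sigma>)) \<longlongrightarrow> 0) at_top"
    by real_asymp
  then have "\<forall>\<^sub>F \<sigma> in at_top. B * 2 powr (2 - \<sigma>) < 1 \<and> \<sigma> > 2"
    by (intro eventually_conj order_tendstoD(2)[of _ 0] eventually_gt_at_top) auto
  then obtain M :: real where M: "B * 2 powr (2 - M) < 1" "M > 2"
    by (auto simp: eventually_at_top_linorder)
  show ?thesis
  proof (rule that[of M])
    fix c :: "nat \<Rightarrow> complex" and s
    assume c: "\<And>n. norm (c n) \<le> b n" and c1: "norm (c 1) = 1" and s: "Re s \<ge> M"
    define g where "g = (\<lambda>n. c n * of_nat n powr (- s))"
    define h where "h = (\<lambda>n. if n = 1 then 0 else g n)"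
    have b_nonneg: "b n \<ge> 0" for n
      using c[of n] norm_ge_zero order_trans by blast
    have summ_g: "summable (\<lambda>n. norm (g n))"
      unfolding g_def using s M by (intro summable_norm_terms c) auto
    \<comment> \<open>for \<open>n \<ge> 2\<close> the excess \<open>M - 2\<close> in the exponent is worth at least a factor \<open>2 powr (M - 2)\<close>\<close>
    have h_le: "norm (h n) \<le> 2 powr (2 - M) * (b n * real n powr (- 2))" for n
    proof (cases "n \<ge> 2")
      case True
      have "norm (h n) \<le> b n * real n powr (- M)"
        using norm_term_le[of c n M s] c s True by (simp add: h_def g_def)
      also have "real n powr (- M) = real n powr (2 - M) * real n powr (- 2)"
        by (simp flip: powr_add)
      also have "b n * (real n powr (2 - M) * real n powr (- 2))
          \<le> b n * (2 powr (2 - M) * real n powr (- 2))"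
        using True M b_nonneg by (intro mult_left_mono mult_right_mono powr_mono2') auto
      finally show ?thesis by (simp add: mult_ac)
    next
      case False
      then have "n = 0 \<or> n = 1" by auto
      then show ?thesis using b_nonneg by (auto simp: h_def g_def)
    qed
    have summ_2: "summable (\<lambda>n. b n * real n powr (- 2))"
      by (rule summable_majorant) simp
    have "summable h"
      by (rule summable_comparison_test'[OF summable_mult[OF summ_2], of 0]) (use h_le in auto)
    have "norm (suminf h) \<le> (\<Sum>n. 2 powr (2 - M) * (b n * real n powr (- 2)))"
      by (intro norm_suminf_le h_le summable_mult summ_2)
    also have "\<dots> = B * 2 powr (2 - M)"
      by (simp add: B_def suminf_mult summ_2)
    finally have small: "norm (suminf h) < 1"
      using M by linarith
    have "dirichlet_sum c s = suminf g"
      unfolding g_def using s M by (intro dirichlet_sum_eq_suminf c) auto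
    also have "g = (\<lambda>n. (if n = 1 then c n else 0) + h n)"
      by (auto simp: h_def g_def)
    also have "suminf \<dots> = c 1 + suminf h"
      using \<open>summable h\<close>
      by (intro sums_unique[symmetric] sums_add sums_single summable_sums)
    finally have "dirichlet_sum c s = c 1 + suminf h" .
    with small c1 show "dirichlet_sum c s \<noteq> 0"
      by (metis add_eq_0_iff less_irrefl norm_minus_cancel)
  qed (use M in simp)
qed

section \<open>Zero-free half-planes in the limit\<close>

text \<open>The normalization of the first coefficient excludes the degenerate case of Hurwitz's theorem: it
  makes the limit nonzero far to the right, so it cannot be constant with a zero.\<close>

lemma zero_free_limit:
  assumes c: "\<And>k n. norm (c k n) \<le> b n" and c': "\<And>n. norm (c' n) \<le> b n"
    and lim: "\<And>n. n \<ge> 1 \<Longrightarrow> (\<lambda>k. c k n) \<longlonglongrightarrow> c' n"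
    and c'1: "norm (c' 1) = 1"
    and \<sigma>: "\<sigma> \<ge> 1"
    and zero_free: "\<And>k s. Re s > \<sigma> \<Longrightarrow> dirichlet_sum (c k) s \<noteq> 0"
    and z: "Re z > \<sigma>"
  shows "dirichlet_sum c' z \<noteq> 0"
proof
  assume zero: "dirichlet_sum c' z = 0"
  let ?H = "{s. Re s > \<sigma>}"
  obtain M where M: "\<And>s. Re s \<ge> M \<Longrightarrow> dirichlet_sum c' s \<noteq> 0"
    by (rule uniformly_zero_free_far_right) (use c' c'1 in blast)
  have nonconst: "\<not> dirichlet_sum c' constant_on ?H"
  proof
    assume "dirichlet_sum c' constant_on ?H"
    then have "dirichlet_sum c' (of_real (max M (\<sigma> + 1))) = dirichlet_sum c' z"
      using z unfolding constant_on_def by (auto simp: max_def)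
    with zero M show False by (auto simp: max_def)
  qed
  have unif: "uniform_limit K (\<lambda>k. dirichlet_sum (c k)) (dirichlet_sum c') sequentially"
    if K: "compact K" "K \<subseteq> ?H" for K
  proof (cases "K = {}")
    case False
    have "continuous_on K Re" by (intro continuous_intros)
    then obtain w where w: "w \<in> K" "\<And>s. s \<in> K \<Longrightarrow> Re w \<le> Re s"
      using continuous_attains_inf[OF K(1) False, of Re] by blast
    have "Re w > 1"
      using w(1) K(2) \<sigma> by auto
    with c c' lim have "uniform_limit {s. Re s \<ge> Re w} (\<lambda>k. dirichlet_sum (c k)) (dirichlet_sum c')
        sequentially"
      by (rule uniform_limit_dirichlet_sum)
    then show ?thesis
      by (rule uniform_limit_on_subset) (use w(2) in auto)
  qed auto
  have holo: "dirichlet_sum g holomorphic_on ?H" if "\<And>n. norm (g n) \<le> b n" for g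
    using holomorphic_dirichlet_sum[OF that] by (rule holomorphic_on_subset) (use \<sigma> in auto)
  have "dirichlet_sum c' z \<noteq> 0"
  proof (rule Hurwitz_no_zeros[of ?H "\<lambda>k. dirichlet_sum (c k)" "dirichlet_sum c'" z])
    show "open ?H" by (rule open_halfspace_Re_gt)
    show "connected ?H" by (intro convex_connected convex_halfspace_Re_gt)
    show "dirichlet_sum (c k) holomorphic_on ?H" for k using c by (rule holo)
    show "dirichlet_sum c' holomorphic_on ?H" using c' by (rule holo)
    show "dirichlet_sum (c k) s \<noteq> 0" if "s \<in> ?H" for k s
      using that zero_free by blast
  qed (use unif nonconst z in blast)+
  with zero show False by simp
qed

lemma tendsto_dirichlet_sum:
  assumes c: "\<And>k n. norm (c k n) \<le> b n" and c': "\<And>n. norm (c' n) \<le> b n"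
    and lim: "\<And>n. n \<ge> 1 \<Longrightarrow> (\<lambda>k. c k n) \<longlonglongrightarrow> c' n"
    and s: "s \<longlonglongrightarrow> z" and z: "Re z > 1"
  shows "(\<lambda>k. dirichlet_sum (c k) (s k)) \<longlonglongrightarrow> dirichlet_sum c' z"
proof -
  define \<sigma> where "\<sigma> = (1 + Re z) / 2"
  have \<sigma>: "\<sigma> > 1" "Re z > \<sigma>" using z by (auto simp: \<sigma>_def)
  have cont: "isCont (dirichlet_sum c') z"
    using holomorphic_on_imp_continuous_on[OF holomorphic_dirichlet_sum, of c'] c' z
    by (auto simp: continuous_on_eq_continuous_at open_halfspace_Re_gt)
  have near: "\<forall>\<^sub>F k in sequentially. Re (s k) > \<sigma>"
    using tendsto_Re[OF s] \<sigma>(2) by (rule order_tendstoD)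
  have unif: "uniform_limit {s. Re s \<ge> \<sigma>} (\<lambda>k. dirichlet_sum (c k)) (dirichlet_sum c') sequentially"
    by (intro uniform_limit_dirichlet_sum c c' lim \<sigma>)
  have "(\<lambda>k. dist (dirichlet_sum (c k) (s k)) (dirichlet_sum c' (s k))) \<longlonglongrightarrow> 0"
  proof (rule order_tendstoI)
    fix e :: real assume "0 < e"
    from uniform_limitD[OF unif this] near
    show "\<forall>\<^sub>F k in sequentially. dist (dirichlet_sum (c k) (s k)) (dirichlet_sum c' (s k)) < e"
      by eventually_elim auto
  next
    fix a :: real assume "a < 0"
    then show "\<forall>\<^sub>F k in sequentially. a < dist (dirichlet_sum (c k) (s k)) (dirichlet_sum c' (s k))"
      by (intro always_eventually allI) (rule less_le_trans[OF _ zero_le_dist])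
  qed
  then have "(\<lambda>k. dirichlet_sum (c k) (s k) - dirichlet_sum c' (s k)) \<longlonglongrightarrow> 0"
    unfolding dist_norm by (rule tendsto_norm_zero_cancel)
  with isCont_tendsto_compose[OF cont s] show ?thesis
    by (rule Lim_transform)
qed

end

section \<open>The abscissa of the zero-free half-plane\<close>

lemma sigma_star_le:
  assumes "\<sigma> \<ge> 1" "\<And>s. Re s > \<sigma> \<Longrightarrow> linear_twist f l s \<noteq> 0"
  shows "sigma_star f l \<le> \<sigma>"
  unfolding sigma_star_def using assms by (intro cInf_lower bdd_belowI[of _ 1]) auto

lemma linear_twist_eq_dirichlet_sum:
  "linear_twist f l = dirichlet_sum (\<lambda>n. f n * unit_exp (of_real l * of_nat n))"
  by (simp add: fun_eq_iff linear_twist_def dirichlet_sum_def)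

lemma norm_unit_exp_of_real [simp]: "norm (unit_exp (of_real y)) = 1"
proof -
  have "unit_exp (of_real y) = exp (\<i> * of_real (2 * pi * y))"
    by (simp add: unit_exp_def mult_ac)
  then show ?thesis by (simp only: norm_exp_i_times)
qed

lemma norm_unit_exp_of_real_mult_of_nat [simp]: "norm (unit_exp (of_real l * of_nat n)) = 1"
  using norm_unit_exp_of_real[of "l * real n"] unfolding of_real_mult of_real_of_nat_eq .

lemma tendsto_unit_exp_of_real_mult_of_nat:
  "x \<longlonglongrightarrow> l \<Longrightarrow>
     (\<lambda>k. unit_exp (of_real (x k) * of_nat n)) \<longlonglongrightarrow> unit_exp (of_real l * of_nat n)"
  unfolding unit_exp_def
  by (intro tendsto_exp tendsto_mult tendsto_const tendsto_of_real)

lemma norm_of_nat_powr_imaginary_le: "norm (of_nat n powr (- (\<i> * of_real t)) :: complex) \<le> 1"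
proof (cases "n = 0")
  case False
  then have "norm (of_nat n powr (- (\<i> * of_real t)) :: complex) = real n powr 0"
    by (subst norm_powr_real_powr) auto
  with False show ?thesis by simp
qed auto

text \<open>Vertical translation only rotates the coefficients, so all translates share one majorant.\<close>

lemma dirichlet_sum_vertical_shift:
  "dirichlet_sum c (s + \<i> * of_real t)
     = dirichlet_sum (\<lambda>n. c n * of_nat n powr (- (\<i> * of_real t))) s"
proof -
  have "of_nat n powr (- (s + \<i> * of_real t))
      = (of_nat n powr (- (\<i> * of_real t)) * of_nat n powr (- s) :: complex)" for n
    by (simp flip: powr_add add: add.commute)
  then show ?thesis by (simp add: dirichlet_sum_def mult.assoc)
qed

lemma dirichlet_majorant_norm:
  assumes "\<And>s. Re s > 1 \<Longrightarrow> (\<lambda>n. norm (f n * of_nat n powr (- s))) summable_on {1..}"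
  shows "dirichlet_majorant (\<lambda>n. norm (f n :: complex))"
proof
  fix \<sigma> :: real assume "\<sigma> > 1"
  then have "(\<lambda>n. norm (f n * of_nat n powr (- of_real \<sigma>))) summable_on {1..}"
    by (intro assms) simp
  also have "?this \<longleftrightarrow> (\<lambda>n. norm (f n) * real n powr (- \<sigma>)) summable_on UNIV"
    by (rule summable_on_cong_neutral)
       (auto simp: not_le norm_mult norm_powr_real_powr simp flip: of_real_minus)
  also have "\<dots> \<longleftrightarrow> summable (\<lambda>n. norm (f n) * real n powr (- \<sigma>))"
    by (rule summable_on_UNIV_nonneg_real_iff) auto
  finally show "summable (\<lambda>n. norm (f n) * real n powr (- \<sigma>))" .
qed

locale normalized_dirichlet_series = dirichlet_majorant "\<lambda>n. norm (f n)"
  for f :: "nat \<Rightarrow> complex" +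
  assumes norm_f_1: "norm (f 1) = 1"
begin

lemma linear_twists_zero_free_far_right:
  obtains M where "M > 1" "\<And>l s. Re s \<ge> M \<Longrightarrow> linear_twist f l s \<noteq> 0"
proof -
  obtain M where M: "M > 1" "\<And>c s. \<lbrakk>\<And>n. norm (c n) \<le> norm (f n); norm (c 1) = 1; Re s \<ge> M\<rbrakk>
      \<Longrightarrow> dirichlet_sum c s \<noteq> 0"
    by (rule uniformly_zero_free_far_right) blast
  show ?thesis
  proof (rule that[OF M(1)])
    fix l s assume "Re s \<ge> M"
    then show "linear_twist f l s \<noteq> 0"
      unfolding linear_twist_eq_dirichlet_sum
      by (intro M(2)) (use norm_f_1 in \<open>simp_all only: norm_mult norm_unit_exp_of_real_mult_of_nat
            mult_1_right order.refl\<close>)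
  qed
qed

lemma sigma_star_ge_1: "sigma_star f l \<ge> 1"
  and linear_twist_nonzero: "Re s > sigma_star f l \<Longrightarrow> linear_twist f l s \<noteq> 0"
proof -
  let ?S = "{\<sigma>0. \<sigma>0 \<ge> 1 \<and> (\<forall>s. Re s > \<sigma>0 \<longrightarrow> linear_twist f l s \<noteq> 0)}"
  obtain M where "M > 1" "\<And>s. Re s \<ge> M \<Longrightarrow> linear_twist f l s \<noteq> 0"
    by (rule linear_twists_zero_free_far_right) blast
  then have S: "M \<in> ?S" by auto
  then show "sigma_star f l \<ge> 1"
    unfolding sigma_star_def by (intro cInf_greatest) auto
  assume "Re s > sigma_star f l"
  then obtain \<sigma>0 where "\<sigma>0 \<in> ?S" "\<sigma>0 < Re s"
    unfolding sigma_star_def using S cInf_lessD[of ?S "Re s"] by blast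
  then show "linear_twist f l s \<noteq> 0" by auto
qed

text \<open>The rotations \<open>n powr (- \<i> t)\<close> form a precompact family even when \<open>t\<close> is unbounded. Their limit
  need not come from any \<open>t\<close>, but the limiting series is approximated both by translates of the
  twists with the given zeros and by translates of the twist by \<open>l\<close>.\<close>

lemma limit_of_zeros_le_sigma_star:
  assumes x: "x \<longlonglongrightarrow> l" and \<sigma>: "\<sigma> > 1"
    and zeros: "\<And>k. linear_twist f (x k) (s k) = 0" and s: "\<And>k. Re (s k) \<ge> \<sigma>"
  shows "\<sigma> \<le> sigma_star f l"
proof (rule ccontr)
  assume "\<not> \<sigma> \<le> sigma_star f l"
  then have less: "sigma_star f l < \<sigma>" by simp
  obtain M where M: "\<And>l s. Re s \<ge> M \<Longrightarrow> linear_twist f l s \<noteq> 0"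
    by (rule linear_twists_zero_free_far_right) blast
  have "Re (s k) < M" for k
    using M[of "s k" "x k"] zeros[of k] by linarith
  with s have "\<forall>k. Re (s k) \<in> {\<sigma>..M}" by (auto intro: less_imp_le)
  then obtain \<sigma>' r1 where \<sigma>': "\<sigma>' \<in> {\<sigma>..M}" and r1: "strict_mono r1"
    and lim_r1: "((\<lambda>k. Re (s k)) \<circ> r1) \<longlonglongrightarrow> \<sigma>'"
    by (rule seq_compactE[OF compact_imp_seq_compact[OF compact_Icc]])
  define rot :: "nat \<Rightarrow> nat \<Rightarrow> complex"
    where "rot = (\<lambda>k n. of_nat n powr (- (\<i> * of_real (Im (s k)))))"
  have rot_le: "norm (rot k n) \<le> 1" for k n
    unfolding rot_def by (rule norm_of_nat_powr_imaginary_le)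
  obtain r2 where r2: "strict_mono r2" and "\<And>n. \<exists>w. (\<lambda>k. rot (r1 (r2 k)) n) \<longlonglongrightarrow> w"
    using function_convergent_subsequence[of UNIV "\<lambda>k n. rot (r1 k) n" 1] rot_le by auto
  then obtain w where w: "\<And>n. (\<lambda>k. rot (r1 (r2 k)) n) \<longlonglongrightarrow> w n"
    by metis
  define r where "r = r1 \<circ> r2"
  have r: "strict_mono r"
    unfolding r_def using r1 r2 by (rule strict_mono_o)
  have lim_rot: "(\<lambda>k. rot (r k) n) \<longlonglongrightarrow> w n" for n
    using w by (simp add: r_def)
  have lim_re: "(\<lambda>k. Re (s (r k))) \<longlonglongrightarrow> \<sigma>'"
    using LIMSEQ_subseq_LIMSEQ[OF lim_r1 r2] by (simp add: r_def o_def)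
  have lim_x: "(\<lambda>k. x (r k)) \<longlonglongrightarrow> l"
    using LIMSEQ_subseq_LIMSEQ[OF x r] by (simp add: o_def)
  have w_le: "norm (w n) \<le> 1" for n
    by (rule tendsto_upperbound[OF tendsto_norm[OF lim_rot]]) (auto intro: always_eventually rot_le)
  have "w 1 = 1"
    using lim_rot[of 1] by (simp add: rot_def LIMSEQ_const_iff)
  define tw where "tw = (\<lambda>y n. f n * unit_exp (of_real y * of_nat n))"
  have le: "norm (tw y n * u) \<le> norm (f n)" if "norm u \<le> 1" for y n u
    using that by (simp add: tw_def norm_mult mult_left_le)
  \<comment> \<open>seen from the twists by \<open>x (r k)\<close>, the limiting series has a zero\<close>
  have "(\<lambda>k. dirichlet_sum (\<lambda>n. tw (x (r k)) n * rot (r k) n) (of_real (Re (s (r k)))))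
      \<longlonglongrightarrow> dirichlet_sum (\<lambda>n. tw l n * w n) (of_real \<sigma>')"
    using \<sigma> \<sigma>' unfolding tw_def
    by (intro tendsto_dirichlet_sum le[unfolded tw_def] rot_le w_le tendsto_mult tendsto_const
          lim_rot tendsto_unit_exp_of_real_mult_of_nat lim_x tendsto_of_real lim_re) auto
  moreover have "dirichlet_sum (\<lambda>n. tw (x (r k)) n * rot (r k) n) (of_real (Re (s (r k)))) = 0" for k
    using zeros[of "r k"]
    by (simp add: rot_def tw_def linear_twist_eq_dirichlet_sum flip: dirichlet_sum_vertical_shift
        complex_eq)
  ultimately have "dirichlet_sum (\<lambda>n. tw l n * w n) (of_real \<sigma>') = 0"
    by (simp add: LIMSEQ_const_iff)
  \<comment> \<open>seen from the translates of the twist by \<open>l\<close>, it has none\<close>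
  moreover have "dirichlet_sum (\<lambda>n. tw l n * w n) (of_real \<sigma>') \<noteq> 0"
  proof (rule zero_free_limit)
    show "norm (tw l n * rot (r k) n) \<le> norm (f n)" for k n
      by (intro le rot_le)
    show "norm (tw l n * w n) \<le> norm (f n)" for n
      by (intro le w_le)
    show "(\<lambda>k. tw l n * rot (r k) n) \<longlonglongrightarrow> tw l n * w n" for n
      by (intro tendsto_intros lim_rot)
    show "norm (tw l 1 * w 1) = 1"
      unfolding tw_def \<open>w 1 = 1\<close> mult_1_right norm_mult norm_unit_exp_of_real_mult_of_nat
      by (rule norm_f_1)
    show "sigma_star f l \<ge> 1" by (rule sigma_star_ge_1)
    show "dirichlet_sum (\<lambda>n. tw l n * rot (r k) n) z \<noteq> 0" if "Re z > sigma_star f l" for k z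
      using linear_twist_nonzero[of l "z + \<i> * of_real (Im (s (r k)))"] that
      by (simp add: rot_def tw_def linear_twist_eq_dirichlet_sum dirichlet_sum_vertical_shift)
    show "Re (of_real \<sigma>') > sigma_star f l"
      using less \<sigma>' by simp
  qed
  ultimately show False by simp
qed

lemma sigma_star_le_limit:
  assumes x: "x \<longlonglongrightarrow> l" and le: "\<And>k. sigma_star f (x k) \<le> \<sigma>"
  shows "sigma_star f l \<le> \<sigma>"
proof (rule sigma_star_le)
  show \<sigma>: "\<sigma> \<ge> 1"
    using sigma_star_ge_1 le[of 0] by (rule order_trans)
  fix s assume s: "Re s > \<sigma>"
  show "linear_twist f l s \<noteq> 0"
    unfolding linear_twist_eq_dirichlet_sum
  proof (rule zero_free_limit[OF _ _ _ _ \<sigma> _ s])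
    show "(\<lambda>k. f n * unit_exp (of_real (x k) * of_nat n)) \<longlonglongrightarrow> f n * unit_exp (of_real l * of_nat n)"
      for n
      by (intro tendsto_mult tendsto_const tendsto_unit_exp_of_real_mult_of_nat x)
    show "dirichlet_sum (\<lambda>n. f n * unit_exp (of_real (x k) * of_nat n)) z \<noteq> 0" if "Re z > \<sigma>" for k z
      using linear_twist_nonzero[of "x k" z] le[of k] that
      by (simp add: linear_twist_eq_dirichlet_sum)
    show "norm (f 1 * unit_exp (of_real l * of_nat 1)) = 1"
      using norm_f_1 by (simp only: norm_mult norm_unit_exp_of_real_mult_of_nat)
  qed (simp_all add: norm_mult)
qed

theorem sigma_star_tendsto:
  assumes x: "x \<longlonglongrightarrow> l"
  shows "(\<lambda>k. sigma_star f (x k)) \<longlonglongrightarrow> sigma_star f l"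
proof (rule order_tendstoI; rule ccontr)
  fix a assume a: "a < sigma_star f l"
    and nev: "\<not> (\<forall>\<^sub>F k in sequentially. a < sigma_star f (x k))"
  obtain r :: "nat \<Rightarrow> nat" where r: "strict_mono r" "\<And>k. sigma_star f (x (r k)) \<le> a"
    using not_eventually_sequentiallyD[OF nev] unfolding not_less by blast
  have "sigma_star f l \<le> a"
    using LIMSEQ_subseq_LIMSEQ[OF x r(1), unfolded o_def] r(2) by (rule sigma_star_le_limit)
  with a show False by simp
next
  fix a assume a: "a > sigma_star f l"
    and nev: "\<not> (\<forall>\<^sub>F k in sequentially. a > sigma_star f (x k))"
  obtain r :: "nat \<Rightarrow> nat" where r: "strict_mono r" "\<And>k. sigma_star f (x (r k)) \<ge> a"
    using not_eventually_sequentiallyD[OF nev] unfolding not_less by blast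
  \<comment> \<open>an intermediate abscissa, since the infimum \<open>a \<le> sigma_star f (x (r k))\<close> alone gives no zero on
    or to the right of the line \<open>Re s = a\<close>\<close>
  obtain \<sigma> where \<sigma>: "sigma_star f l < \<sigma>" "\<sigma> < a"
    using dense[OF a] by blast
  have \<sigma>1: "\<sigma> > 1"
    using sigma_star_ge_1[of l] \<sigma>(1) by simp
  have "\<exists>s. Re s > \<sigma> \<and> linear_twist f (x (r k)) s = 0" for k
  proof (rule ccontr)
    assume "\<not> ?thesis"
    then have "sigma_star f (x (r k)) \<le> \<sigma>"
      using \<sigma>1 by (intro sigma_star_le) auto
    with r(2)[of k] \<sigma>(2) show False by simp
  qed
  then obtain s where s: "\<And>k. Re (s k) > \<sigma>" "\<And>k. linear_twist f (x (r k)) (s k) = 0"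
    by metis
  have "\<sigma> \<le> sigma_star f l"
  proof (rule limit_of_zeros_le_sigma_star)
    show "(\<lambda>k. x (r k)) \<longlonglongrightarrow> l"
      using LIMSEQ_subseq_LIMSEQ[OF x r(1)] by (simp add: o_def)
  qed (use \<sigma>1 s(2) less_imp_le[OF s(1)] in auto)
  with \<sigma> show False by simp
qed

end

section \<open>Continuity of the abscissa\<close>

theorem theorem3:
  fixes f :: "nat \<Rightarrow> complex"
    and d :: nat
    and fj :: "nat \<Rightarrow> nat \<Rightarrow> complex"
    and logF :: "complex \<Rightarrow> complex"
    and lam :: real
    and x :: "nat \<Rightarrow> real"
  assumes mult: "multiplicative_fun f"
    and abs_conv: "\<And>s. Re s > 1 \<Longrightarrow> (\<lambda>n. norm (f n * of_nat n powr (- s))) summable_on {1..}"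
    and d_pos: "d \<ge> 1"
    and logF: "\<And>s. Re s > 1 \<Longrightarrow> exp (logF s) = dirichlet_sum f s"
    and euler: "\<And>s. Re s > 1 \<Longrightarrow>
      ((\<lambda>p. - (\<Sum>j=1..d. Ln (1 - fj j p * of_nat p powr (- s)))) has_sum logF s) {p. prime p}"
    and fj_bound: "\<And>j p. prime p \<Longrightarrow> j \<in> {1..d} \<Longrightarrow> norm (fj j p) \<le> 1"
    and mean_square: "\<exists>C>0. \<forall>X\<ge>1. (\<Sum>n | 1 \<le> n \<and> real n \<le> X. (norm (f n))\<^sup>2) \<le> C * X"
    and primes: "\<exists>x0 A. x0 > 0 \<and> A > 6 \<and>
      (\<exists>c>0. \<forall>X\<ge>x0. (\<Sum>p | prime p \<and> real p \<le> X. (norm (f p))\<^sup>2) \<ge> c * (X / ln X)) \<and>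
      (\<exists>C>0. \<forall>X\<ge>x0. \<forall>q ch.
         dirichlet_character q ch \<and> ch \<noteq> principal_character q \<and> real q \<le> ln X powr A \<longrightarrow>
         norm (\<Sum>p | prime p \<and> real p \<le> X. of_real ((norm (f p))\<^sup>2) * ch p)
           \<le> C * (1 / real (totient q) * (X / (ln X)\<^sup>2)))"
    and lambda: "0 < lam" "lam < 1" "lam \<noteq> 1 / 2"
    and x_range: "\<And>n. x n \<in> {0<..1}"
    and x_lim: "x \<longlonglongrightarrow> lam"
  shows "(\<lambda>n. sigma_star f (x n)) \<longlonglongrightarrow> sigma_star f lam"
proof -
  interpret dirichlet_majorant "\<lambda>n. norm (f n)"
    using abs_conv by (rule dirichlet_majorant_norm)
  interpret normalized_dirichlet_series f
    by standard (use mult in \<open>simp add: multiplicative_fun_def\<close>)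
  show ?thesis
    using x_lim by (rule sigma_star_tendsto)
qed

end
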